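(* Let $G$ be a locally finite graph with a relative weight function $\mathbf{w}$ and a linear ordering $<$ on its (undirected) edges. Let $M$ be the $\mathbf{w}$-maximal subforest of $G$ with respect to the tiebreaker $<$. Then every $\mathbf{w}$-infinite connected component of $G$ splits into $\mathbf{w}$-infinite trees in $M$; that is, for each $\mathbf{w}$-infinite component $C$ of $G$, every connected component of $M$ contained in $C$ is $\mathbf{w}$-infinite.
   Context: Graphs are simple and undirected. A relative weight function on $G$ is a map $\mathbf{w}$ assigning to each pair $(x,y)$ of vertices in the same component of $G$ a positive real $\mathbf{w}^y(x)=\mathbf{w}(x,y)$ with $\mathbf{w}(x,y)\mathbf{w}(y,z)=\mathbf{w}(x,z)$. A set $A$ of vertices contained in a single component is $\mathbf{w}$-infinite if $\sum_{x\in A}\mathbf{w}^b(x)=\infty$ for some (equivalently every) basepoint $b$ in that component. For an edge $e=\{x,y\}$ in the component of $b$, put $\tilde{\mathbf{w}}^b(e):=\min\{\mathbf{w}^b(x),\mathbf{w}^b(y)\}$. For edges $e_1,e_2$ in the same component define $e_1<_{\mathbf{w}}e_2$ iff $\tilde{\mathbf{w}}^b(e_1)<\tilde{\mathbf{w}}^b(e_2)$, or $\tilde{\mathbf{w}}^b(e_1)=\tilde{\mathbf{w}}^b(e_2)$ and $e_1<e_2$; this does not depend on $b$. The $\mathbf{w}$-maximal subforest $M$ of $G$ is the subgraph, with the same vertex set, obtained by deleting simultaneously from each simple cycle of $G$ (a closed path with at least three edges and no other repeated vertices) its $<_{\mathbf{w}}$-least edge. *)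

theory Defs
  imports "HOL-Analysis.Analysis"
begin

record 'a ugraph =
  verts :: "'a set"
  edges :: "'a set set"

definition simple_graph :: "'a ugraph \<Rightarrow> bool" where
  "simple_graph G \<longleftrightarrow> (\<forall>e\<in>edges G. e \<subseteq> verts G \<and> card e = 2)"

definition adj :: "'a ugraph \<Rightarrow> 'a \<Rightarrow> 'a \<Rightarrow> bool" where
  "adj G x y \<longleftrightarrow> {x, y} \<in> edges G"

definition locally_finite :: "'a ugraph \<Rightarrow> bool" where
  "locally_finite G \<longleftrightarrow> (\<forall>v\<in>verts G. finite {e\<in>edges G. v \<in> e})"

definition same_component :: "'a ugraph \<Rightarrow> 'a \<Rightarrow> 'a \<Rightarrow> bool" where
  "same_component G x y \<longleftrightarrow> x \<in> verts G \<and> y \<in> verts G \<and> (adj G)\<^sup>*\<^sup>* x y"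

text \<open>Components are represented by their vertex sets.\<close>

definition graph_components :: "'a ugraph \<Rightarrow> 'a set set" where
  "graph_components G = {{y. same_component G x y} | x. x \<in> verts G}"

text \<open>A closed path is a vertex list whose first and last entries agree, so a list
  with at least four entries traverses at least three edges.\<close>

definition simple_cycle :: "'a ugraph \<Rightarrow> 'a list \<Rightarrow> bool" where
  "simple_cycle G c \<longleftrightarrow>
     length c \<ge> 4 \<and> hd c = last c \<and> distinct (tl c) \<and> successively (adj G) c"

definition path_edges :: "'a list \<Rightarrow> 'a set set" where
  "path_edges c = {{x, y} | x y. (x, y) \<in> set (zip c (tl c))}"

definition connected_graph :: "'a ugraph \<Rightarrow> bool" where
  "connected_graph G \<longleftrightarrow> verts G \<noteq> {} \<and> (\<forall>x\<in>verts G. \<forall>y\<in>verts G. same_component G x y)"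

definition is_tree :: "'a ugraph \<Rightarrow> bool" where
  "is_tree G \<longleftrightarrow> simple_graph G \<and> connected_graph G \<and> \<not> (\<exists>c. simple_cycle G c)"

definition induced :: "'a ugraph \<Rightarrow> 'a set \<Rightarrow> 'a ugraph" where
  "induced G A = \<lparr>verts = A, edges = {e\<in>edges G. e \<subseteq> A}\<rparr>"

text \<open>Here \<open>w x y\<close> is the weight \<open>w\<^sup>y(x)\<close> of \<open>x\<close> relative to the basepoint \<open>y\<close>;
  values on pairs from different components are irrelevant.\<close>

definition relative_weight :: "'a ugraph \<Rightarrow> ('a \<Rightarrow> 'a \<Rightarrow> real) \<Rightarrow> bool" where
  "relative_weight G w \<longleftrightarrow>
     (\<forall>x y. same_component G x y \<longrightarrow> w x y > 0) \<and>
     (\<forall>x y z. same_component G x y \<and> same_component G y z \<longrightarrow> w x y * w y z = w x z)"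

definition w_infinite :: "'a ugraph \<Rightarrow> ('a \<Rightarrow> 'a \<Rightarrow> real) \<Rightarrow> 'a set \<Rightarrow> bool" where
  "w_infinite G w A \<longleftrightarrow>
     (\<exists>C\<in>graph_components G. A \<subseteq> C \<and> (\<exists>b\<in>C. (\<Sum>\<^sub>\<infinity>x\<in>A. ennreal (w x b)) = \<infinity>))"

definition edge_weight :: "('a \<Rightarrow> 'a \<Rightarrow> real) \<Rightarrow> 'a \<Rightarrow> 'a set \<Rightarrow> real" where
  "edge_weight w b e = Min ((\<lambda>x. w x b) ` e)"

text \<open>The tiebreaker is a set \<open>r\<close> of pairs of edges, with \<open>(e, f) \<in> r\<close> meaning that \<open>e\<close> is
  smaller than \<open>f\<close>. The choice of basepoint \<open>b\<close> below is immaterial, see \<open>edge_less_iff\<close>.\<close>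

definition edge_less ::
    "'a ugraph \<Rightarrow> ('a \<Rightarrow> 'a \<Rightarrow> real) \<Rightarrow> 'a set rel \<Rightarrow> 'a set \<Rightarrow> 'a set \<Rightarrow> bool" where
  "edge_less G w r e f \<longleftrightarrow>
     e \<in> edges G \<and> f \<in> edges G \<and>
     (\<exists>C\<in>graph_components G. e \<subseteq> C \<and> f \<subseteq> C \<and>
       (\<exists>b\<in>C. edge_weight w b e < edge_weight w b f \<or>
              edge_weight w b e = edge_weight w b f \<and> (e, f) \<in> r))"

definition least_cycle_edge ::
    "'a ugraph \<Rightarrow> ('a \<Rightarrow> 'a \<Rightarrow> real) \<Rightarrow> 'a set rel \<Rightarrow> 'a list \<Rightarrow> 'a set \<Rightarrow> bool" where
  "least_cycle_edge G w r c e \<longleftrightarrow>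
     e \<in> path_edges c \<and> (\<forall>f\<in>path_edges c - {e}. edge_less G w r e f)"

definition maximal_subforest ::
    "'a ugraph \<Rightarrow> ('a \<Rightarrow> 'a \<Rightarrow> real) \<Rightarrow> 'a set rel \<Rightarrow> 'a ugraph" where
  "maximal_subforest G w r =
     \<lparr>verts = verts G,
      edges = edges G - {e. \<exists>c. simple_cycle G c \<and> least_cycle_edge G w r c e}\<rparr>"


subsection \<open>Independence of the basepoint\<close>

lemma same_component_sym:
  assumes "same_component G x y" shows "same_component G y x"
proof -
  have "symp (adj G)"
    by (auto simp: symp_def adj_def insert_commute)
  then have "symp (adj G)\<^sup>*\<^sup>*"
    by (rule symp_rtranclp)
  then show ?thesis
    using assms by (auto simp: same_component_def dest: sympD)
qed

lemma same_component_trans: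
  "same_component G x y \<Longrightarrow> same_component G y z \<Longrightarrow> same_component G x z"
  by (auto simp: same_component_def)

lemma graph_componentsD:
  assumes "C \<in> graph_components G" "x \<in> C"
  shows "y \<in> C \<longleftrightarrow> same_component G x y"
  using assms unfolding graph_components_def
  by (auto intro: same_component_trans dest: same_component_sym)

lemma edge_weight_rebase:
  assumes "relative_weight G w" "C \<in> graph_components G" "e \<subseteq> C" "finite e" "e \<noteq> {}" "b \<in> C" "b' \<in> C"
  shows "edge_weight w b' e = edge_weight w b e * w b b'"
proof -
  have pos: "w b b' > 0"
    using assms(1,2,6,7) graph_componentsD by (metis relative_weight_def)
  have "(\<lambda>x. w x b') ` e = (\<lambda>t. t * w b b') ` ((\<lambda>x. w x b) ` e)"
    unfolding image_image
  proof (rule image_cong)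
    fix x assume "x \<in> e"
    then have "same_component G x b" "same_component G b b'"
      using assms by (auto simp: graph_componentsD[symmetric] intro: same_component_sym)
    then show "w x b' = w x b * w b b'"
      using assms(1) by (simp add: relative_weight_def)
  qed simp
  moreover have "mono (\<lambda>t. t * w b b')"
    using pos by (auto intro!: monoI mult_right_mono)
  ultimately show ?thesis
    using mono_Min_commute[of "\<lambda>t. t * w b b'" "(\<lambda>x. w x b) ` e"] assms
    unfolding edge_weight_def by simp
qed

lemma edge_less_iff:
  assumes "simple_graph G" "relative_weight G w" "C \<in> graph_components G"
    and "e \<in> edges G" "f \<in> edges G" "e \<subseteq> C" "f \<subseteq> C" "b \<in> C"
  shows "edge_less G w r e f \<longleftrightarrow>
           edge_weight w b e < edge_weight w b f \<or>
           edge_weight w b e = edge_weight w b f \<and> (e, f) \<in> r"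
proof -
  have card: "card e = 2" "card f = 2"
    using assms by (auto simp: simple_graph_def)
  then have fin: "finite e" "finite f" "e \<noteq> {}" "f \<noteq> {}"
    by (auto intro: card_ge_0_finite)
  have uniq: "C' = C" if "C' \<in> graph_components G" "e \<subseteq> C'" for C'
  proof -
    obtain x where "x \<in> e" using fin by blast
    then show ?thesis
      using that assms graph_componentsD[of C' G x] graph_componentsD[of C G x] by blast
  qed
  have rebase: "edge_weight w b' e < edge_weight w b' f \<longleftrightarrow> edge_weight w b e < edge_weight w b f"
       "edge_weight w b' e = edge_weight w b' f \<longleftrightarrow> edge_weight w b e = edge_weight w b f"
    if "b' \<in> C" for b'
  proof -
    have "w b b' > 0"
      using assms(2,3,8) that graph_componentsD by (metis relative_weight_def)
    then show "edge_weight w b' e < edge_weight w b' f \<longleftrightarrow> edge_weight w b e < edge_weight w b f"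
       "edge_weight w b' e = edge_weight w b' f \<longleftrightarrow> edge_weight w b e = edge_weight w b f"
      using edge_weight_rebase[OF assms(2,3) _ _ _ assms(8) that] assms fin by simp_all
  qed
  show ?thesis
    using assms uniq rebase unfolding edge_less_def by blast
qed

lemma w_infinite_iff:
  assumes "relative_weight G w" "C \<in> graph_components G" "A \<subseteq> C" "b \<in> C"
  shows "w_infinite G w A \<longleftrightarrow> (\<Sum>\<^sub>\<infinity>x\<in>A. ennreal (w x b)) = \<infinity>"
proof
  assume "w_infinite G w A"
  then obtain C' b' where C': "C' \<in> graph_components G" "A \<subseteq> C'" "b' \<in> C'"
    and inf: "(\<Sum>\<^sub>\<infinity>x\<in>A. ennreal (w x b')) = \<infinity>"
    by (auto simp: w_infinite_def)
  then have "A \<noteq> {}" by auto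
  then obtain a where "a \<in> A" by blast
  then have b': "b' \<in> C"
    using C' assms graph_componentsD[of C' G a] graph_componentsD[of C G a] by blast
  have bb': "same_component G b b'"
    using assms b' graph_componentsD by metis
  then have pos: "w b b' > 0"
    using assms by (auto simp: relative_weight_def)
  have "(\<Sum>\<^sub>\<infinity>x\<in>A. ennreal (w x b')) = (\<Sum>\<^sub>\<infinity>x\<in>A. ennreal (w b b') * ennreal (w x b))"
  proof (rule infsum_cong)
    fix x assume "x \<in> A"
    then have xb: "same_component G x b"
      using assms graph_componentsD by (metis subsetD)
    then have "w x b * w b b' = w x b'" "w x b > 0"
      using assms(1) bb' by (auto simp: relative_weight_def)
    then show "ennreal (w x b') = ennreal (w b b') * ennreal (w x b)"
      using pos by (metis ennreal_mult less_imp_le mult.commute)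
  qed
  also have "\<dots> = ennreal (w b b') * (\<Sum>\<^sub>\<infinity>x\<in>A. ennreal (w x b))"
    by (simp add: nonneg_infsum_complete SUP_mult_left_ennreal sum_distrib_left)
  finally show "(\<Sum>\<^sub>\<infinity>x\<in>A. ennreal (w x b)) = \<infinity>"
    using inf by (metis ennreal_mult_eq_top_iff ennreal_neq_top infinity_ennreal_def)
qed (use assms in \<open>auto simp: w_infinite_def\<close>)

end

theory Submission
  imports Defs
begin

text \<open>Let \<open>D\<close> be a component of \<open>M\<close> that is not a whole component of \<open>G\<close>. If \<open>D\<close> had
  finite weight, then by local finiteness only finitely many edges leaving \<open>D\<close> would be at
  least as heavy as a given one, so there would be a greatest edge \<open>e\<close> leaving \<open>D\<close>. As \<open>e\<close> is
  not in \<open>M\<close>, it is the least edge of some cycle, but this cycle leaves \<open>D\<close> through a second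
  edge, which is greater than \<open>e\<close>.\<close>

section \<open>Edges of simple cycles, by position\<close>

lemma path_edges_conv_nth: "path_edges c = {{c ! i, c ! Suc i} | i. Suc i < length c}"
proof -
  have "(x, y) \<in> set (zip c (tl c)) \<longleftrightarrow> (\<exists>i. Suc i < length c \<and> x = c ! i \<and> y = c ! Suc i)" for x y
    by (cases c) (auto simp: in_set_zip)
  then show ?thesis
    by (auto simp: path_edges_def)
qed

lemma finite_path_edges: "finite (path_edges c)"
proof -
  have "path_edges c = (\<lambda>(x, y). {x, y}) ` set (zip c (tl c))"
    by (auto simp: path_edges_def)
  then show ?thesis by simp
qed

lemma simple_cycle_edges_subset:
  assumes "simple_cycle G c" shows "path_edges c \<subseteq> edges G"
  using assms by (auto simp: simple_cycle_def path_edges_conv_nth successively_conv_nth adj_def)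

lemma simple_cycle_closed:
  assumes "simple_cycle G c" shows "c ! 0 = c ! (length c - 1)"
proof -
  have "c \<noteq> []" and "hd c = last c"
    using assms by (auto simp: simple_cycle_def)
  then show ?thesis by (simp add: hd_conv_nth last_conv_nth)
qed

text \<open>Equal edges at two positions would have to be traversed in opposite directions, since
  their end points \<open>c ! Suc i\<close> and \<open>c ! Suc j\<close> differ. Then the cycle goes
  along an edge and straight back, which is possible only for a closed path with two edges.\<close>

lemma simple_cycle_edge_inj:
  assumes c: "simple_cycle G c" and ij: "i < j" "Suc j < length c"
  shows "{c ! i, c ! Suc i} \<noteq> {c ! j, c ! Suc j}"
proof
  assume eq: "{c ! i, c ! Suc i} = {c ! j, c ! Suc j}"
  note closed = simple_cycle_closed[OF c]
  have len: "length c \<ge> 4" and d: "distinct (tl c)"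
    using c by (auto simp: simple_cycle_def)
  \<comment> \<open>Distinctness of \<open>tl c\<close> concerns positions from 1 on; position 0
    repeats the last vertex and is handled through \<open>closed\<close>.\<close>
  have inj: "a = b" if "c ! a = c ! b" "0 < a" "0 < b" "a < length c" "b < length c" for a b
    using d that nth_eq_iff_index_eq[of "tl c" "a - 1" "b - 1"]
    by (cases a; cases b) (auto simp: nth_tl less_diff_conv)
  have "c ! Suc i \<noteq> c ! Suc j"
    using inj[of "Suc i" "Suc j"] ij by auto
  then have 1: "c ! Suc i = c ! j" "c ! i = c ! Suc j"
    using eq by (auto simp: doubleton_eq_iff)
  have j: "j = Suc i"
    using inj[OF 1(1)] ij by auto
  show False
  proof (cases "i = 0")
    case True
    \<comment> \<open>Here \<open>Suc j\<close> is 2, whereas the last position is at least 3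
      because a cycle has at least three edges.\<close>
    then have "c ! Suc j = c ! (length c - 1)"
      using 1(2) closed by simp
    moreover have "0 < length c - 1" "length c - 1 < length c" "Suc j \<noteq> length c - 1"
      using True j len by auto
    ultimately show ?thesis
      using inj[of "Suc j" "length c - 1"] ij(2) by blast
  next
    case False
    then show ?thesis
      using inj[OF 1(2)] ij by simp
  qed
qed

text \<open>Membership in \<open>D\<close> changes at \<open>e\<close> and must change back before
  the closed path returns to its start. As \<open>e\<close> is traversed only once, another edge
  does this.\<close>

lemma simple_cycle_second_cut_edge:
  assumes c: "simple_cycle G c" and e: "e \<in> path_edges c" "e \<inter> D \<noteq> {}" "\<not> e \<subseteq> D"
  shows "\<exists>f\<in>path_edges c. f \<noteq> e \<and> f \<inter> D \<noteq> {} \<and> \<not> f \<subseteq> D"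
proof (rule ccontr)
  assume no: "\<not> ?thesis"
  obtain i where i: "Suc i < length c" and ei: "e = {c ! i, c ! Suc i}"
    using e(1) by (auto simp: path_edges_conv_nth)
  have step: "c ! Suc j \<in> D \<longleftrightarrow> c ! j \<in> D" if j: "Suc j < length c" "j \<noteq> i" for j
  proof -
    have "{c ! j, c ! Suc j} \<in> path_edges c"
      using j by (auto simp: path_edges_conv_nth)
    moreover have "{c ! j, c ! Suc j} \<noteq> e"
      using simple_cycle_edge_inj[OF c, of i j] simple_cycle_edge_inj[OF c, of j i] i j ei
      by (metis linorder_neqE_nat)
    ultimately have "{c ! j, c ! Suc j} \<inter> D = {} \<or> {c ! j, c ! Suc j} \<subseteq> D"
      using no by metis
    then show ?thesis by auto
  qed
  \<comment> \<open>Removing position \<open>i\<close> leaves two stretches, from 0 to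
    \<open>i\<close> and from \<open>Suc i\<close> to the end, on each of which membership in
    \<open>D\<close> is constant. They are joined at the common first and last vertex.\<close>
  have before: "j \<le> i \<Longrightarrow> c ! j \<in> D \<longleftrightarrow> c ! 0 \<in> D" for j
    by (induction j) (use step i in auto)
  have after: "Suc i + k < length c \<Longrightarrow> c ! (Suc i + k) \<in> D \<longleftrightarrow> c ! Suc i \<in> D" for k
    by (induction k) (use step in auto)
  have "Suc i + (length c - 1 - Suc i) = length c - 1"
    using i by simp
  then have "c ! (length c - 1) \<in> D \<longleftrightarrow> c ! Suc i \<in> D"
    using after[of "length c - 1 - Suc i"] i by simp
  then have "c ! Suc i \<in> D \<longleftrightarrow> c ! i \<in> D"
    using before[of i] simple_cycle_closed[OF c] by simp
  then show False using e(2,3) ei by auto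
qed

section \<open>Cuts and components\<close>

lemma rtranclp_cut_edge:
  assumes "(adj G)\<^sup>*\<^sup>* x y" "x \<in> D" "y \<notin> D"
  shows "\<exists>e\<in>edges G. e \<inter> D \<noteq> {} \<and> \<not> e \<subseteq> D"
  using assms
proof (induction rule: rtranclp_induct)
  case (step y z)
  then show ?case
    by (cases "y \<in> D") (auto simp: adj_def intro!: bexI[of _ "{y, z}"])
qed simp

lemma component_edge_subset:
  assumes "simple_graph G" "C \<in> graph_components G" "e \<in> edges G" "e \<inter> C \<noteq> {}"
  shows "e \<subseteq> C"
proof
  fix y assume y: "y \<in> e"
  obtain x where x: "x \<in> e" "x \<in> C" using assms(4) by blast
  have e: "card e = 2" "e \<subseteq> verts G"
    using assms(1,3) by (auto simp: simple_graph_def)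
  show "y \<in> C"
  proof (cases "x = y")
    case False
    have "e = {x, y}"
      using e(1) x(1) y False by (auto simp: card_2_iff)
    then have "same_component G x y"
      using assms(3) e(2) x(1) y by (auto simp: same_component_def adj_def)
    then show ?thesis
      using graph_componentsD[OF assms(2) x(2)] by simp
  qed (use x in simp)
qed

section \<open>The edge order inside one component\<close>

context
  fixes G :: "'a ugraph" and w :: "'a \<Rightarrow> 'a \<Rightarrow> real" and r :: "'a set rel" and C :: "'a set"
  assumes G: "simple_graph G" and w: "relative_weight G w"
    and r: "strict_linear_order_on (edges G) r" and C: "C \<in> graph_components G"
begin

text \<open>One basepoint serves all edges inside \<open>C\<close>, and with it the relation is the
  lexicographic order of edge weight and tiebreaker. Edges in different components are incomparable,
  hence the restriction to \<open>C\<close>.\<close>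

lemma edge_less_linear:
  assumes "A \<subseteq> {e \<in> edges G. e \<subseteq> C}"
  shows "transp_on A (edge_less G w r)" "totalp_on A (edge_less G w r)" "irreflp_on A (edge_less G w r)"
proof -
  obtain b where b: "b \<in> C"
    using C by (auto simp: graph_components_def same_component_def)
  have iff: "edge_less G w r e f \<longleftrightarrow>
      edge_weight w b e < edge_weight w b f \<or>
      edge_weight w b e = edge_weight w b f \<and> (e, f) \<in> r" if "e \<in> A" "f \<in> A" for e f
    using edge_less_iff[OF G w C _ _ _ _ b] that assms by blast
  have r': "trans r" "irrefl r" "total_on (edges G) r"
    using r by (auto simp: strict_linear_order_on_def)
  show "transp_on A (edge_less G w r)"
  proof (rule transp_onI)
    fix e f g assume A: "e \<in> A" "f \<in> A" "g \<in> A" and "edge_less G w r e f" "edge_less G w r f g"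
    then show "edge_less G w r e g"
      unfolding iff[OF A(1,2)] iff[OF A(2,3)] iff[OF A(1,3)] using transD[OF r'(1), of e f g] by linarith
  qed
  show "totalp_on A (edge_less G w r)"
  proof (rule totalp_onI)
    fix e f assume A: "e \<in> A" "f \<in> A" and "e \<noteq> f"
    then have "(e, f) \<in> r \<or> (f, e) \<in> r"
      using r'(3) assms by (auto simp: total_on_def)
    then show "edge_less G w r e f \<or> edge_less G w r f e"
      unfolding iff[OF A] iff[OF A(2,1)] by linarith
  qed
  show "irreflp_on A (edge_less G w r)"
    by (rule irreflp_onI) (use iff r'(2) in \<open>auto simp: irrefl_def\<close>)
qed

text \<open>This makes every cycle lose an edge in the maximal subforest, which is what acyclicity
  rests on.\<close>

lemma least_cycle_edge_exists:
  assumes c: "simple_cycle G c" and sub: "path_edges c \<subseteq> Pow C"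
  shows "\<exists>e. least_cycle_edge G w r c e"
proof -
  have A: "path_edges c \<subseteq> {e \<in> edges G. e \<subseteq> C}"
    using simple_cycle_edges_subset[OF c] sub by auto
  have "length c \<ge> 4" using c by (simp add: simple_cycle_def)
  then have "{c ! 0, c ! Suc 0} \<in> path_edges c"
    by (auto simp: path_edges_conv_nth intro!: exI[of _ 0])
  then have "path_edges c \<noteq> {}" by blast
  then obtain e where "e \<in> path_edges c" "\<forall>f\<in>path_edges c. f \<noteq> e \<longrightarrow> edge_less G w r e f"
    using Finite_Set.bex_least_element[OF finite_path_edges _ edge_less_linear(1,2)[OF A]] by blast
  then show ?thesis
    by (auto simp: least_cycle_edge_def)
qed

text \<open>The weight of an edge is the minimum over its ends, so a heavy edge meeting
  \<open>D\<close> has a heavy end in \<open>D\<close>. Infinitely many vertices of weight at least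
  \<open>t\<close> would make the sum over \<open>D\<close> diverge, and each vertex lies on
  finitely many edges.\<close>

lemma finite_heavy_cut_edges:
  assumes lf: "locally_finite G" and D: "D \<subseteq> C" "\<not> w_infinite G w D" and b: "b \<in> C" and t: "t > 0"
  shows "finite {e \<in> edges G. e \<inter> D \<noteq> {} \<and> t \<le> edge_weight w b e}"
proof -
  define S where "S = {x \<in> D. t \<le> w x b}"
  have "finite S"
  proof (rule ccontr)
    assume inf: "infinite S"
    have "(\<Sum>\<^sub>\<infinity>x\<in>S. ennreal (w x b)) = \<infinity>"
      by (rule infsum_superconst_infinite_ennreal[OF _ _ inf, of "ennreal t"])
         (use t in \<open>auto simp: S_def intro: ennreal_leI\<close>)
    moreover have "(\<Sum>\<^sub>\<infinity>x\<in>S. ennreal (w x b)) \<le> (\<Sum>\<^sub>\<infinity>x\<in>D. ennreal (w x b))"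
      by (rule infsum_mono_neutral) (auto simp: S_def nonneg_summable_on_complete)
    ultimately have "(\<Sum>\<^sub>\<infinity>x\<in>D. ennreal (w x b)) = \<infinity>"
      by (simp add: top_unique)
    then show False
      using w_infinite_iff[OF w C D(1) b] D(2) by simp
  qed
  moreover have "S \<subseteq> verts G"
    using D(1) C by (auto simp: S_def graph_components_def same_component_def)
  ultimately have "finite (\<Union>x\<in>S. {e \<in> edges G. x \<in> e})"
    using lf by (auto simp: locally_finite_def)
  moreover have "{e \<in> edges G. e \<inter> D \<noteq> {} \<and> t \<le> edge_weight w b e} \<subseteq> (\<Union>x\<in>S. {e \<in> edges G. x \<in> e})"
  proof
    fix e assume "e \<in> {e \<in> edges G. e \<inter> D \<noteq> {} \<and> t \<le> edge_weight w b e}"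
    then obtain x where e: "e \<in> edges G" "t \<le> edge_weight w b e" "x \<in> e" "x \<in> D"
      by blast
    have "finite e"
      using G e(1) by (auto simp: simple_graph_def intro: card_ge_0_finite)
    then have "edge_weight w b e \<le> w x b"
      using e(3) by (auto simp: edge_weight_def)
    then show "e \<in> (\<Union>x\<in>S. {e \<in> edges G. x \<in> e})"
      using e by (auto simp: S_def)
  qed
  ultimately show ?thesis
    using finite_subset by blast
qed

lemma greatest_cut_edge:
  assumes lf: "locally_finite G" and D: "D \<subseteq> C" "\<not> w_infinite G w D"
    and f: "f \<in> edges G" "f \<inter> D \<noteq> {}" "\<not> f \<subseteq> D"
  obtains e where "e \<in> edges G" "e \<inter> D \<noteq> {}" "\<not> e \<subseteq> D"
    "\<And>g. g \<in> edges G \<Longrightarrow> g \<inter> D \<noteq> {} \<Longrightarrow> \<not> g \<subseteq> D \<Longrightarrow> \<not> edge_less G w r e g"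
proof -
  obtain b where b: "b \<in> C" using f D by blast
  define B where "B = {e \<in> edges G. e \<inter> D \<noteq> {} \<and> \<not> e \<subseteq> D}"
  \<comment> \<open>The cut \<open>B\<close> may be infinite, so the maximum is sought among the
    edges at least as heavy as the given \<open>f\<close>; these are finitely many.\<close>
  define A where "A = {e \<in> B. edge_weight w b f \<le> edge_weight w b e}"
  have BC: "B \<subseteq> {e \<in> edges G. e \<subseteq> C}"
  proof
    fix e assume "e \<in> B"
    then show "e \<in> {e \<in> edges G. e \<subseteq> C}"
      using component_edge_subset[OF G C, of e] D(1) by (auto simp: B_def)
  qed
  have fB: "f \<in> B" using f by (simp add: B_def)
  have "finite f" "f \<noteq> {}" "f \<subseteq> C"
    using G f(1,2) fB BC by (auto simp: simple_graph_def intro: card_ge_0_finite)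
  moreover have "w x b > 0" if "x \<in> C" for x
    using w that b graph_componentsD[OF C] by (auto simp: relative_weight_def)
  ultimately have "edge_weight w b f > 0"
    by (auto simp: edge_weight_def)
  from finite_heavy_cut_edges[OF lf D b this] have "finite A"
    by (rule rev_finite_subset) (auto simp: A_def B_def)
  moreover have "A \<noteq> {}" using fB by (auto simp: A_def)
  moreover have AC: "A \<subseteq> {e \<in> edges G. e \<subseteq> C}" using BC by (auto simp: A_def)
  ultimately obtain e where e: "e \<in> A" "\<forall>g\<in>A. g \<noteq> e \<longrightarrow> edge_less G w r g e"
    using Finite_Set.bex_greatest_element[OF _ _ edge_less_linear(1,2)[OF AC]] by blast
  have "\<not> edge_less G w r e g" if g: "g \<in> B" for g
  proof
    assume less: "edge_less G w r e g"
    have "e \<in> B" using e(1) by (simp add: A_def)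
    \<comment> \<open>An edge of the cut above \<open>e\<close> is at least as heavy as
      \<open>e\<close>, hence as \<open>f\<close>, so it already competed in
      \<open>A\<close>.\<close>
    then have "edge_weight w b e \<le> edge_weight w b g"
      using less edge_less_iff[OF G w C, of e g b r] BC g b by fastforce
    then have "g \<in> A" using g e(1) by (auto simp: A_def)
    then show False
      using e less edge_less_linear(1,3)[OF AC] unfolding transp_on_def irreflp_on_def by metis
  qed
  then show ?thesis
    using that[of e] e(1) by (auto simp: A_def B_def)
qed

end

section \<open>Components of the maximal subforest\<close>

lemma adj_maximal_subforest:
  "adj (maximal_subforest G w r) x y \<Longrightarrow> adj G x y"
  by (simp add: adj_def maximal_subforest_def)

lemma same_component_maximal_subforest:
  "same_component (maximal_subforest G w r) x y \<Longrightarrow> same_component G x y"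
  using rtranclp_mono[of "adj (maximal_subforest G w r)" "adj G"] adj_maximal_subforest[of G w r]
  by (auto simp: same_component_def) (auto simp: maximal_subforest_def)

text \<open>A path of \<open>M\<close> starting in \<open>D\<close> never leaves \<open>D\<close>,
  so all its edges survive in the induced subgraph.\<close>

lemma connected_induced_component:
  assumes M: "simple_graph M" and D: "D \<in> graph_components M"
  shows "connected_graph (induced M D)"
proof -
  have "y \<in> D \<and> (adj (induced M D))\<^sup>*\<^sup>* x y" if "(adj M)\<^sup>*\<^sup>* x y" "x \<in> D" for x y
    using that
  proof (induction rule: rtranclp_induct)
    case (step y z)
    then have yz: "{y, z} \<in> edges M" "y \<in> D"
      by (auto simp: adj_def)
    then have "{y, z} \<subseteq> D"
      using component_edge_subset[OF M D, of "{y, z}"] by blast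
    then show ?case
      using step yz by (auto simp: adj_def induced_def intro: rtranclp.rtrancl_into_rtrancl)
  qed simp
  then have "same_component (induced M D) x y" if "x \<in> D" "y \<in> D" for x y
    using graph_componentsD[OF D that(1)] that by (simp add: same_component_def induced_def)
  moreover have "D \<noteq> {}"
    using D by (auto simp: graph_components_def same_component_def)
  ultimately show ?thesis
    by (simp add: connected_graph_def) (simp add: induced_def)
qed

theorem proposition1p9:
  fixes G :: "'a ugraph"
    and w :: "'a \<Rightarrow> 'a \<Rightarrow> real"
    and r :: "'a set rel"
    and M :: "'a ugraph"
    and C :: "'a set"
  assumes "simple_graph G"
    and "locally_finite G"
    and "relative_weight G w"
    and "strict_linear_order_on (edges G) r"
    and "M = maximal_subforest G w r"
    and "C \<in> graph_components G"
    and "w_infinite G w C"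
  shows "C = \<Union>{D \<in> graph_components M. D \<subseteq> C} \<and>
         (\<forall>D\<in>graph_components M. D \<subseteq> C \<longrightarrow> is_tree (induced M D) \<and> w_infinite G w D)"
proof (intro conjI ballI impI)
  note G = assms(1) and lf = assms(2) and w = assms(3) and r = assms(4) and M = assms(5)
    and C = assms(6) and inf = assms(7)
  have vM: "verts M = verts G" and eM: "edges M \<subseteq> edges G"
    by (auto simp: M maximal_subforest_def)
  have sM: "simple_graph M"
    using G vM eM by (auto simp: simple_graph_def)
  show "C = \<Union>{D \<in> graph_components M. D \<subseteq> C}"
  proof
    show "C \<subseteq> \<Union>{D \<in> graph_components M. D \<subseteq> C}"
    proof
      fix x assume x: "x \<in> C"
      then have xM: "x \<in> verts M"
        using C vM by (auto simp: graph_components_def same_component_def)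
      have "{y. same_component M x y} \<subseteq> C"
        unfolding M by (auto simp: graph_componentsD[OF C x] dest: same_component_maximal_subforest)
      moreover have "{y. same_component M x y} \<in> graph_components M"
        using xM by (auto simp: graph_components_def)
      moreover have "x \<in> {y. same_component M x y}"
        using xM by (simp add: same_component_def)
      ultimately show "x \<in> \<Union>{D \<in> graph_components M. D \<subseteq> C}"
        by blast
    qed
  qed blast
  fix D assume D: "D \<in> graph_components M" "D \<subseteq> C"
  show "is_tree (induced M D)"
    unfolding is_tree_def
  proof (intro conjI notI)
    show "simple_graph (induced M D)"
      using sM by (auto simp: simple_graph_def induced_def)
    show "connected_graph (induced M D)"
      by (rule connected_induced_component[OF sM D(1)])
    assume "\<exists>c. simple_cycle (induced M D) c"
    then obtain c where c: "simple_cycle (induced M D) c" by blast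
    have sub: "path_edges c \<subseteq> {e \<in> edges M. e \<subseteq> D}"
      using simple_cycle_edges_subset[OF c] by (simp add: induced_def)
    have cG: "simple_cycle G c"
      using c eM unfolding simple_cycle_def
      by (auto simp: adj_def induced_def elim!: successively_mono)
    have "path_edges c \<subseteq> Pow C"
      using sub D(2) by blast
    \<comment> \<open>The least edge of this cycle was deleted from \<open>M\<close>, yet all edges
      of the cycle lie in \<open>M\<close>.\<close>
    then obtain e where e: "least_cycle_edge G w r c e"
      using least_cycle_edge_exists[OF G w r C cG] by blast
    then have "e \<notin> edges M"
      using cG by (auto simp: M maximal_subforest_def)
    then show False
      using e sub by (auto simp: least_cycle_edge_def)
  qed
  show "w_infinite G w D"
  proof (rule ccontr)
    assume fin: "\<not> w_infinite G w D"
    obtain x where x: "x \<in> D"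
      using D(1) by (auto simp: graph_components_def same_component_def)
    \<comment> \<open>\<open>C\<close> is infinite in weight and \<open>D\<close> is not, so
      \<open>D\<close> is a proper subset of \<open>C\<close>.\<close>
    obtain y where y: "y \<in> C" "y \<notin> D"
      using fin inf D(2) by (metis subsetI subset_antisym)
    have "(adj G)\<^sup>*\<^sup>* x y"
      using graph_componentsD[OF C, of x y] x y D(2) by (auto simp: same_component_def)
    then obtain f where "f \<in> edges G" "f \<inter> D \<noteq> {}" "\<not> f \<subseteq> D"
      using rtranclp_cut_edge x y by metis
    then obtain e where e: "e \<in> edges G" "e \<inter> D \<noteq> {}" "\<not> e \<subseteq> D"
      and greatest: "\<And>g. g \<in> edges G \<Longrightarrow> g \<inter> D \<noteq> {} \<Longrightarrow> \<not> g \<subseteq> D \<Longrightarrow> \<not> edge_less G w r e g"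
      using greatest_cut_edge[OF G w r C lf D(2) fin] by metis
    \<comment> \<open>An edge of \<open>M\<close> meeting the component \<open>D\<close> of
      \<open>M\<close> would lie inside it.\<close>
    have "e \<notin> edges M"
      using component_edge_subset[OF sM D(1)] e by blast
    then obtain c where c: "simple_cycle G c" "least_cycle_edge G w r c e"
      using e(1) by (auto simp: M maximal_subforest_def)
    \<comment> \<open>The cycle crosses the boundary of \<open>D\<close> a second time at
      \<open>g\<close>. Leastness of \<open>e\<close> on the cycle puts \<open>g\<close> above
      \<open>e\<close>, against the choice of \<open>e\<close> as greatest.\<close>
    then obtain g where "g \<in> path_edges c" "g \<noteq> e" "g \<inter> D \<noteq> {}" "\<not> g \<subseteq> D"
      using simple_cycle_second_cut_edge[OF c(1), of e D] e by (auto simp: least_cycle_edge_def)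
    then show False
      using greatest c simple_cycle_edges_subset[OF c(1)] by (auto simp: least_cycle_edge_def)
  qed
qed

end
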